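(* Let $k\in\mathbb I^{\mathrm m}_{t|t-1}\cup\{\mathrm u,\flat\}$ and $z\in\bar Z_t=Z_t\cup\{\phi\}$. Assume that (approximation A.3, applied to the hypotheses $\mathbb I^{\mathrm m}_{t|t-1}\setminus\{k\}$ and the observations $Z_t\setminus\{z\}$) $$p^{k',\mathrm d}_t(z')\,p^{k'',\mathrm d}_t(z')=0\quad\text{for all } z'\in Z_t\setminus\{z\}\text{ and all } k',k''\in\mathbb I^{\mathrm m}_{t|t-1}\setminus\{k\}\text{ with }k'\neq k''.$$ Then $$w_{\mathrm{ex}}^{k,z}=C'_t(k,z)\prod_{k'\in\mathbb I^{\mathrm m}_{t|t-1}\setminus\{k\}}\Big[\bar p^{k',\mathrm d}_t(\phi)+\sum_{z'\in Z_t\setminus\{z\}}\frac{p^{k',\mathrm d}_t(z')}{C^{\mathrm u,\flat}_t(z')}\Big],$$ where $$C^{\mathrm u,\flat}_t(z')=\frac{p^{\mathrm u,\mathrm d}_t(z')}{\bar p^{\mathrm u,\mathrm d}_t(\phi)}+\frac{p^{\flat,z'}_t(z')}{\bar p^{\flat,z'}_t(\phi)}$$ and $$C'_t(k,z)=\big[\bar p^{\mathrm u,\mathrm d}_t(\phi)\big]^{n^{\mathrm u}_{t|t-1}-\mathbf 1_{\mathrm u}(k)}\Big[\prod_{z'\in Z'_t\setminus Z_\flat}\bar p^{\flat,z'}_t(\phi)\Big]\Big[\prod_{z'\in Z_t\setminus\{z\}}C^{\mathrm u,\flat}_t(z')\Big],$$ with $Z_\flat=\{z\}$ if $k=\flat$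 and $Z_\flat=\emptyset$ otherwise, and $\mathbf 1_{\mathrm u}(k)=1$ if $k=\mathrm u$ and $0$ otherwise.
   Context: Fix a time $t$. **Spaces and observations.** $\bar{\mathbf X}=\mathbf X\cup\{\varphi\}$, $\mathbf X=\mathbf X^\bullet\cup\{\psi_\sharp,\psi_\flat\}$, $\mathbf X^\bullet=\mathbb R^d$; $\psi_\sharp$ (absent targets), $\psi_\flat$ (false-alarm generators) and $\varphi$ (false hypotheses) are isolated points. The observation space is $\mathbf Z^\bullet\cup\{\phi\}$ with $\phi$ the isolated "empty observation". Integrals are Lebesgue integrals on the continuous part plus sums over the isolated points. $Z'_t$ is the finite set of indices of the sensor's resolution cells, $Z_t\subseteq Z'_t$ is the set of indices of the received observations, $A^z_t\subseteq\mathbf Z^\bullet$ is the set corresponding to observation $z\in Z_t$, and $A^\phi_t=\{\phi\}$; $\phi\notin Z'_t$. **Likelihoods.** $\ell^{\mathrm d}_t(\cdot\mid\mathbf x)$ is the target-detection likelihood, a probability law on $\mathbf Z^\bullet\cup\{\phi\}$ for each $\mathbf x\in\bar{\mathbf X}\setminus\{\psi_\flat\}$, with $\ell^{\mathrm d}_t(\phi\mid\psi_\sharp)=\ell^{\mathrm d}_t(\phi\mid\varphi)=1$ and $\ell^{\mathrm d}_t(\cdot\mid\psi_\flat)=0$. For each cell $z\in Z'_t$ there is a false-alarm likelihood $\ell^z_t$, used exactly once, supported on $\mathbf x=\psi_\flat$, which generates a false alarm in cell $z$ with probability $w^{\flat,z}_t\in[0,1]$ and $\phi$ with probability $1-w^{\flat,z}_t$.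 Put $L^{s,z}_t(\mathbf x)=\int\mathbf 1_{A^z_t}(\mathbf z)\,\ell^s_t(\mathbf z\mid\mathbf x)\,\mathrm d\mathbf z$ for $s\in Z'_t\cup\{\mathrm d\}$. **Hypotheses.** $\mathbb I^{\mathrm m}_{t|t-1}$ is the finite index set of the predicted hypotheses for previously detected targets, each with a predicted probability law $\bar p^k_{t|t-1}$ on $\bar{\mathbf X}$ and multiplicity one. The symbol $\mathrm u$ denotes the group of $n^{\mathrm u}_{t|t-1}\in\mathbb N$ never-detected targets with common predicted law $\bar p^{\mathrm u}_{t|t-1}$, with $n^{\mathrm u}_{t|t-1}>|Z_t|$ (standing assumption of the model). The symbol $\flat$ denotes the false-alarm generators, with law $\delta_{\psi_\flat}$. For $k\in\mathbb I^{\mathrm m}_{t|t-1}\cup\{\mathrm u\}$ and $z\in\bar Z_t$, $$p^{k,\mathrm d}_t(z)=\int_{\mathbf X}L^{\mathrm d,z}_t(\mathbf x)\,\bar p^k_{t|t-1}(\mathbf x)\,\mathrm d\mathbf x,\qquad \bar p^{k,\mathrm d}_t(z)=p^{k,\mathrm d}_t(z)+L^{\mathrm d,z}_t(\varphi)\,\bar p^k_{t|t-1}(\varphi).$$ For false alarms, $p^{\flat,z}_t(z)=\bar p^{\flat,z}_t(z)=L^{z,z}_t(\psi_\flat)$ for $z\in Z_t$ and $\bar p^{\flat,z}_t(\phi)=\ell^z_t(\phi\mid\psi_\flat)=1-w^{\flat,z}_t$ for $z\in Z'_t$. All denominators appearing in the claim are assumed nonzero. **Multi-target marginal likelihood.**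 For $M\subseteq\mathbb I^{\mathrm m}_{t|t-1}$, $Y\subseteq S\subseteq Z'_t$ with $Y\subseteq Z_t$, and $n\ge|Y|$, the multi-target marginal likelihood of the update by the observations $Y$ of the hypotheses $M$, of $n$ never-detected targets, and of the false-alarm likelihoods with indices in $S$, is $$W(M,Y,S,n)=\sum_{(J,\tau,Y_{\mathrm u},Y_\flat)}\Big[\prod_{k\in J}p^{k,\mathrm d}_t(\tau(k))\Big]\Big[\prod_{k\in M\setminus J}\bar p^{k,\mathrm d}_t(\phi)\Big]\big[\bar p^{\mathrm u,\mathrm d}_t(\phi)\big]^{n-|Y_{\mathrm u}|}\Big[\prod_{y\in Y_{\mathrm u}}p^{\mathrm u,\mathrm d}_t(y)\Big]\Big[\prod_{y\in Y_\flat}p^{\flat,y}_t(y)\Big]\Big[\prod_{y\in S\setminus Y_\flat}\bar p^{\flat,y}_t(\phi)\Big],$$ the sum being over all $J\subseteq M$, injective maps $\tau:J\to Y$, and $Y_{\mathrm u},Y_\flat\subseteq Y$ such that $Y$ is the disjoint union of $\tau(J)$, $Y_{\mathrm u}$ and $Y_\flat$ (each observation comes from exactly one object, and each object gives at most one observation). The quantity $w_{\mathrm{ex}}^{k,z}$ is the multi-target marginal likelihood of the update, by the observations in $Z_t\setminus\{z\}$, of the system from which (one target of) the hypothesis $k$ has been removed: $$w_{\mathrm{ex}}^{k,z}=W\big(\mathbb I^{\mathrm m}_{t|t-1}\setminus\{k\},\;Z_t\setminus\{z\},\;Z'_t\setminus Z_\flat,\;n^{\mathrm u}_{t|t-1}-\mathbf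 1_{\mathrm u}(k)\big),$$ with $Z_\flat=\{z\}$ if $k=\flat$ and $Z_\flat=\emptyset$ otherwise. *)

theory Defs
  imports "HOL-Analysis.Analysis"
begin

text \<open>
  The spaces $\bar X = R^d \cup \{\psi_\sharp, \psi_\flat, \varphi\}$ and
  $Z^\bullet \cup \{\phi\}$ are data types; all points except \<open>Pt x\<close> and \<open>Obs \<zeta>\<close> are isolated.
  Throughout, probability laws are densities with respect to Lebesgue measure on the continuous
  part and counting measure on the isolated points.
\<close>

datatype 'd state = Pt "real ^ 'd" | Psi_sharp | Psi_flat | Varphi

datatype 'b obs = Obs 'b | No_obs

definition integral_X :: "('d::finite state \<Rightarrow> real) \<Rightarrow> real" where
  "integral_X f = (LINT x|lebesgue. f (Pt x)) + f Psi_sharp + f Psi_flat"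

definition integral_Xbar :: "('d::finite state \<Rightarrow> real) \<Rightarrow> real" where
  "integral_Xbar f = integral_X f + f Varphi"

definition obs_space :: "'b set \<Rightarrow> 'b obs set" where
  "obs_space D = Obs ` D \<union> {No_obs}"

definition integral_Z :: "'b::euclidean_space set \<Rightarrow> ('b obs \<Rightarrow> real) \<Rightarrow> real" where
  "integral_Z D f = (LINT \<zeta>:D|lebesgue. f (Obs \<zeta>)) + f No_obs"

definition law_Xbar :: "('d::finite state \<Rightarrow> real) \<Rightarrow> bool" where
  "law_Xbar p \<longleftrightarrow>
     (\<forall>x. 0 \<le> p x) \<and> integrable lebesgue (\<lambda>x. p (Pt x)) \<and> integral_Xbar p = 1"

definition law_Z :: "'b::euclidean_space set \<Rightarrow> ('b obs \<Rightarrow> real) \<Rightarrow> bool" where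
  "law_Z D q \<longleftrightarrow>
     (\<forall>\<zeta>\<in>obs_space D. 0 \<le> q \<zeta>) \<and> set_integrable lebesgue D (\<lambda>\<zeta>. q (Obs \<zeta>)) \<and>
     integral_Z D q = 1"

text \<open>
  The data of one update step. Observation indices have type \<open>'i\<close>, hypothesis indices type \<open>'k\<close>;
  \<open>phi\<close> is the index of the empty observation, \<open>und\<close> the group of never-detected targets and
  \<open>flat\<close> the false-alarm generators. The region \<open>cell s\<close> of a resolution cell is kept separate
  from the set \<open>obs_set z\<close> of a received observation, which may be smaller.
\<close>

record ('d::finite, 'b, 'i, 'k) update =
  Zdot :: "'b set"
  cells :: "'i set"
  cell :: "'i \<Rightarrow> 'b obs set"
  received :: "'i set"
  phi :: "'i"
  obs_set :: "'i \<Rightarrow> 'b obs set"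
  lik_d :: "'b obs \<Rightarrow> 'd state \<Rightarrow> real"
  lik_fa :: "'i \<Rightarrow> 'b obs \<Rightarrow> 'd state \<Rightarrow> real"
  w_fa :: "'i \<Rightarrow> real"
  hyps :: "'k set"
  und :: "'k"
  flat :: "'k"
  predicted :: "'k \<Rightarrow> 'd state \<Rightarrow> real"
  n_und :: nat

text \<open>\<open>L_lik U l z x\<close> is the likelihood $L^{s,z}(x)$, where \<open>l\<close> is the likelihood
  $\ell^s$, that is, \<open>lik_d U\<close> or \<open>lik_fa U s\<close>.\<close>

definition L_lik ::
  "('d::finite, 'b::euclidean_space, 'i, 'k) update \<Rightarrow> ('b obs \<Rightarrow> 'd state \<Rightarrow> real) \<Rightarrow> 'i \<Rightarrow> 'd state \<Rightarrow> real"
where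
  "L_lik U l z x = integral_Z (Zdot U) (\<lambda>\<zeta>. indicator (obs_set U z) \<zeta> * l \<zeta> x)"

text \<open>The measurability conditions are those needed for the integrals to be meaningful.\<close>

definition update_model :: "('d::finite, 'b::euclidean_space, 'i, 'k) update \<Rightarrow> bool" where
  "update_model U \<longleftrightarrow>
     Zdot U \<in> sets lebesgue \<and>
     finite (cells U) \<and> received U \<subseteq> cells U \<and> phi U \<notin> cells U \<and>
     (\<forall>s\<in>cells U. cell U s \<subseteq> Obs ` Zdot U \<and> Obs -` cell U s \<in> sets lebesgue) \<and>
     (\<forall>z\<in>received U. obs_set U z \<subseteq> Obs ` Zdot U \<and> Obs -` obs_set U z \<in> sets lebesgue) \<and>
     obs_set U (phi U) = {No_obs} \<and>
     (\<forall>x. x \<noteq> Psi_flat \<longrightarrow> law_Z (Zdot U) (\<lambda>\<zeta>. lik_d U \<zeta> x)) \<and>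
     lik_d U No_obs Psi_sharp = 1 \<and> lik_d U No_obs Varphi = 1 \<and>
     (\<forall>\<zeta>\<in>obs_space (Zdot U). lik_d U \<zeta> Psi_flat = 0) \<and>
     (\<forall>z\<in>received U \<union> {phi U}.
        (\<lambda>x. L_lik U (lik_d U) z (Pt x)) \<in> borel_measurable lebesgue) \<and>
     (\<forall>s\<in>cells U.
        0 \<le> w_fa U s \<and> w_fa U s \<le> 1 \<and>
        law_Z (Zdot U) (\<lambda>\<zeta>. lik_fa U s \<zeta> Psi_flat) \<and>
        integral_Z (Zdot U) (\<lambda>\<zeta>. indicator (cell U s) \<zeta> * lik_fa U s \<zeta> Psi_flat) = w_fa U s \<and>
        lik_fa U s No_obs Psi_flat = 1 - w_fa U s \<and>
        (\<forall>\<zeta>\<in>obs_space (Zdot U). \<forall>x. x \<noteq> Psi_flat \<longrightarrow> lik_fa U s \<zeta> x = 0)) \<and>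
     finite (hyps U) \<and> und U \<notin> hyps U \<and> flat U \<notin> hyps U \<and> und U \<noteq> flat U \<and>
     (\<forall>k\<in>hyps U \<union> {und U}. law_Xbar (predicted U k)) \<and>
     card (received U) < n_und U"

definition p_d :: "('d::finite, 'b::euclidean_space, 'i, 'k) update \<Rightarrow> 'k \<Rightarrow> 'i \<Rightarrow> real" where
  "p_d U k z = integral_X (\<lambda>x. L_lik U (lik_d U) z x * predicted U k x)"

definition pbar_d :: "('d::finite, 'b::euclidean_space, 'i, 'k) update \<Rightarrow> 'k \<Rightarrow> 'i \<Rightarrow> real" where
  "pbar_d U k z = p_d U k z + L_lik U (lik_d U) z Varphi * predicted U k Varphi"

definition p_fa :: "('d::finite, 'b::euclidean_space, 'i, 'k) update \<Rightarrow> 'i \<Rightarrow> real" where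
  "p_fa U z = L_lik U (lik_fa U z) z Psi_flat"

text \<open>$\bar p^{\flat,z}(\phi)$\<close>

definition pbar_fa_phi :: "('d::finite, 'b, 'i, 'k) update \<Rightarrow> 'i \<Rightarrow> real" where
  "pbar_fa_phi U z = lik_fa U z No_obs Psi_flat"

text \<open>Association quadruples $(J, \tau, Y_u, Y_\flat)$; \<open>\<tau>\<close> is taken extensional
  so that each map \<open>J \<rightarrow> Y\<close> is counted once.\<close>

definition associations :: "'k set \<Rightarrow> 'i set \<Rightarrow> ('k set \<times> ('k \<Rightarrow> 'i) \<times> 'i set \<times> 'i set) set" where
  "associations M Y =
     {(J, \<tau>, Yu, Yf). J \<subseteq> M \<and> \<tau> \<in> J \<rightarrow>\<^sub>E Y \<and> inj_on \<tau> J \<and> Yu \<subseteq> Y \<and> Yf \<subseteq> Y \<and>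
        Y = \<tau> ` J \<union> Yu \<union> Yf \<and> \<tau> ` J \<inter> Yu = {} \<and> \<tau> ` J \<inter> Yf = {} \<and> Yu \<inter> Yf = {}}"

text \<open>Meant for \<open>M \<subseteq> hyps U\<close>, \<open>Y \<subseteq> S \<subseteq> cells U\<close>, \<open>Y \<subseteq> received U\<close> and \<open>card Y \<le> n\<close>,
  so that the subtraction in the exponent does not truncate.\<close>

definition marginal_lik ::
  "('d::finite, 'b::euclidean_space, 'i, 'k) update \<Rightarrow> 'k set \<Rightarrow> 'i set \<Rightarrow> 'i set \<Rightarrow> nat \<Rightarrow> real"
where
  "marginal_lik U M Y S n =
     (\<Sum>(J, \<tau>, Yu, Yf)\<in>associations M Y.
        (\<Prod>k\<in>J. p_d U k (\<tau> k)) *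
        (\<Prod>k\<in>M - J. pbar_d U k (phi U)) *
        pbar_d U (und U) (phi U) ^ (n - card Yu) *
        (\<Prod>y\<in>Yu. p_d U (und U) y) *
        (\<Prod>y\<in>Yf. p_fa U y) *
        (\<Prod>y\<in>S - Yf. pbar_fa_phi U y))"

definition Z_flat :: "('d::finite, 'b, 'i, 'k) update \<Rightarrow> 'k \<Rightarrow> 'i \<Rightarrow> 'i set" where
  "Z_flat U k z = (if k = flat U then {z} else {})"

definition w_ex :: "('d::finite, 'b::euclidean_space, 'i, 'k) update \<Rightarrow> 'k \<Rightarrow> 'i \<Rightarrow> real" where
  "w_ex U k z =
     marginal_lik U (hyps U - {k}) (received U - {z}) (cells U - Z_flat U k z)
       (n_und U - (if k = und U then 1 else 0))"

definition C_uf :: "('d::finite, 'b::euclidean_space, 'i, 'k) update \<Rightarrow> 'i \<Rightarrow> real" where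
  "C_uf U z = p_d U (und U) z / pbar_d U (und U) (phi U) + p_fa U z / pbar_fa_phi U z"

definition C' :: "('d::finite, 'b::euclidean_space, 'i, 'k) update \<Rightarrow> 'k \<Rightarrow> 'i \<Rightarrow> real" where
  "C' U k z =
     pbar_d U (und U) (phi U) ^ (n_und U - (if k = und U then 1 else 0)) *
     (\<Prod>z'\<in>cells U - Z_flat U k z. pbar_fa_phi U z') *
     (\<Prod>z'\<in>received U - {z}. C_uf U z')"

end

theory Submission
  imports Defs
begin

text \<open>
  Compare each association with the one in which nothing is detected. Once
  $\bar p^{u}(\phi)^n \prod_{y \in S} \bar p^{\flat,y}(\phi)$ has been taken out of its weight
  (\<open>marginal_lik_factorises\<close>), an observation explained by a never-detected target carries the ratio
  $a_y = p^u(y) / \bar p^u(\phi)$, and one explained by a false alarm the ratio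
  $c_y = p^{\flat,y}(y) / \bar p^{\flat,y}(\phi)$. The observations left over by a matching $\tau$
  are split freely between these two explanations, so together they contribute
  $\prod_{y \in Y - \tau(J)} (a_y + c_y)$, by the binomial expansion of a product of sums
  (\<open>sum_associations\<close>).

  Here $a_y + c_y$ is $C^{u,\flat}(y)$. Taking out the product of these over all of $Y$ leaves the
  weight $p^k(\tau(k)) / C^{u,\flat}(\tau(k))$ for each matched hypothesis, so what remains is a sum
  over partial injections of products over hypotheses. The injectivity of $\tau$ is the only
  coupling between the hypotheses, and the exclusion assumption removes it: a map that sends two
  hypotheses to the same observation has weight zero and can be added to the sum. The sum over all
  partial maps then factorises over the hypotheses (\<open>sum_partial_injections\<close>).
\<close>

text \<open>
  The complement $Y_\flat = (Y - \tau(J)) - Y_u$ is determined by the other three components, so an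
  association amounts to a partial injection together with an arbitrary subset $Y_u$ of the
  observations that it leaves over.
\<close>

lemma sum_associations:
  fixes w :: "'k set \<Rightarrow> ('k \<Rightarrow> 'i) \<Rightarrow> 'a::comm_semiring_1"
  assumes "finite M" "finite Y"
  shows "(\<Sum>(J, \<tau>, Yu, Yf)\<in>associations M Y. w J \<tau> * ((\<Prod>y\<in>Yu. a y) * (\<Prod>y\<in>Yf. c y))) =
    (\<Sum>J\<in>Pow M. \<Sum>\<tau>\<in>{\<tau> \<in> J \<rightarrow>\<^sub>E Y. inj_on \<tau> J}. w J \<tau> * (\<Prod>y\<in>Y - \<tau> ` J. a y + c y))"
proof -
  let ?T = "\<lambda>J. {\<tau> \<in> J \<rightarrow>\<^sub>E Y. inj_on \<tau> J}"
  let ?I = "SIGMA J:Pow M. SIGMA \<tau>:?T J. Pow (Y - \<tau> ` J)"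
  let ?g = "\<lambda>J \<tau> Yu. w J \<tau> * ((\<Prod>y\<in>Yu. a y) * (\<Prod>y\<in>Y - \<tau> ` J - Yu. c y))"
  have fin: "finite (?T J)" if "J \<in> Pow M" for J
    using that assms finite_subset[of J M] by (simp add: finite_PiE)
  have "(\<Sum>(J, \<tau>, Yu, Yf)\<in>associations M Y. w J \<tau> * ((\<Prod>y\<in>Yu. a y) * (\<Prod>y\<in>Yf. c y))) =
      (\<Sum>(J, \<tau>, Yu)\<in>?I. ?g J \<tau> Yu)"
  proof (rule sum.reindex_bij_witness[of _
        "\<lambda>(J, \<tau>, Yu). (J, \<tau>, Yu, Y - \<tau> ` J - Yu)" "\<lambda>(J, \<tau>, Yu, Yf). (J, \<tau>, Yu)"])
    fix x assume x: "x \<in> associations M Y"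
    obtain J \<tau> Yu Yf where eq: "x = (J, \<tau>, Yu, Yf)" by (cases x)
    have Yf: "Y - \<tau> ` J - Yu = Yf"
      using x unfolding eq associations_def by blast
    show "(case case x of (J, \<tau>, Yu, Yf) \<Rightarrow> (J, \<tau>, Yu) of
        (J, \<tau>, Yu) \<Rightarrow> (J, \<tau>, Yu, Y - \<tau> ` J - Yu)) = x"
      by (simp add: eq Yf)
    show "(case x of (J, \<tau>, Yu, Yf) \<Rightarrow> (J, \<tau>, Yu)) \<in> ?I"
      using x unfolding eq associations_def by auto
    show "(case case x of (J, \<tau>, Yu, Yf) \<Rightarrow> (J, \<tau>, Yu) of (J, \<tau>, Yu) \<Rightarrow> ?g J \<tau> Yu) =
        (case x of (J, \<tau>, Yu, Yf) \<Rightarrow> w J \<tau> * ((\<Prod>y\<in>Yu. a y) * (\<Prod>y\<in>Yf. c y)))"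
      by (simp add: eq Yf)
  next
    fix x assume x: "x \<in> ?I"
    obtain J \<tau> Yu where eq: "x = (J, \<tau>, Yu)" by (cases x)
    show "(case case x of (J, \<tau>, Yu) \<Rightarrow> (J, \<tau>, Yu, Y - \<tau> ` J - Yu) of
        (J, \<tau>, Yu, Yf) \<Rightarrow> (J, \<tau>, Yu)) = x"
      by (simp add: eq)
    have J: "J \<subseteq> M" and \<tau>: "\<tau> \<in> J \<rightarrow>\<^sub>E Y" "inj_on \<tau> J" and Yu: "Yu \<subseteq> Y - \<tau> ` J"
      using x unfolding eq by auto
    have "\<tau> ` J \<subseteq> Y" using \<tau>(1) by auto
    then show "(case x of (J, \<tau>, Yu) \<Rightarrow> (J, \<tau>, Yu, Y - \<tau> ` J - Yu)) \<in> associations M Y"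
      using J \<tau> Yu unfolding eq associations_def prod.case mem_Collect_eq by blast
  qed
  also have "\<dots> = (\<Sum>J\<in>Pow M. \<Sum>\<tau>\<in>?T J. \<Sum>Yu\<in>Pow (Y - \<tau> ` J). ?g J \<tau> Yu)"
    using assms fin by (simp add: sum.Sigma)
  also have "\<dots> = (\<Sum>J\<in>Pow M. \<Sum>\<tau>\<in>?T J. w J \<tau> * (\<Prod>y\<in>Y - \<tau> ` J. a y + c y))"
    using assms(2) by (simp add: prod_add sum_distrib_left)
  finally show ?thesis .
qed

text \<open>
  The weight of a map that is not injective contains one of the vanishing products; hence the sum
  equals the sum over all partial maps, which is the expansion of the product on the right.
\<close>

lemma sum_partial_injections:
  fixes q :: "'k \<Rightarrow> 'a::comm_semiring_1"
  assumes "finite M" "finite Y"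
    and excl: "\<And>y k k'. y \<in> Y \<Longrightarrow> k \<in> M \<Longrightarrow> k' \<in> M \<Longrightarrow> k \<noteq> k' \<Longrightarrow> r k y * r k' y = 0"
  shows "(\<Sum>J\<in>Pow M. \<Sum>\<tau>\<in>{\<tau> \<in> J \<rightarrow>\<^sub>E Y. inj_on \<tau> J}. (\<Prod>k\<in>J. r k (\<tau> k)) * (\<Prod>k\<in>M - J. q k)) =
    (\<Prod>k\<in>M. q k + (\<Sum>y\<in>Y. r k y))"
proof -
  have zero: "(\<Prod>k\<in>J. r k (\<tau> k)) = 0"
    if J: "J \<subseteq> M" and \<tau>: "\<tau> \<in> J \<rightarrow>\<^sub>E Y" and ninj: "\<not> inj_on \<tau> J" for J \<tau>
  proof -
    obtain k k' where k: "k \<in> J" "k' \<in> J" "k \<noteq> k'" "\<tau> k = \<tau> k'"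
      using ninj unfolding inj_on_def by blast
    have "finite J" using J assms(1) finite_subset by blast
    then have "(\<Prod>k\<in>J. r k (\<tau> k)) =
        r k (\<tau> k) * (r k' (\<tau> k') * (\<Prod>k\<in>J - {k} - {k'}. r k (\<tau> k)))"
      using k by (simp add: prod.remove[of J k] prod.remove[of "J - {k}" k'])
    moreover have "r k (\<tau> k) * r k' (\<tau> k') = 0"
      using excl[of "\<tau> k'" k k'] k J \<tau> by auto
    ultimately show ?thesis by (simp only: mult.assoc[symmetric] mult_zero_left)
  qed
  have inner: "(\<Sum>\<tau>\<in>{\<tau> \<in> J \<rightarrow>\<^sub>E Y. inj_on \<tau> J}. (\<Prod>k\<in>J. r k (\<tau> k)) * (\<Prod>k\<in>M - J. q k)) =
      (\<Prod>k\<in>J. \<Sum>y\<in>Y. r k y) * (\<Prod>k\<in>M - J. q k)" if J: "J \<subseteq> M" for J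
  proof -
    have finJ: "finite J" using J assms(1) finite_subset by blast
    have "(\<Sum>\<tau>\<in>{\<tau> \<in> J \<rightarrow>\<^sub>E Y. inj_on \<tau> J}. (\<Prod>k\<in>J. r k (\<tau> k)) * (\<Prod>k\<in>M - J. q k)) =
        (\<Sum>\<tau>\<in>J \<rightarrow>\<^sub>E Y. (\<Prod>k\<in>J. r k (\<tau> k)) * (\<Prod>k\<in>M - J. q k))"
      using finJ assms(2) zero[OF J] by (intro sum.mono_neutral_left) (auto intro: finite_PiE)
    also have "\<dots> = (\<Prod>k\<in>J. \<Sum>y\<in>Y. r k y) * (\<Prod>k\<in>M - J. q k)"
      using finJ assms(2) by (simp add: prod_sum_PiE sum_distrib_right)
    finally show ?thesis .
  qed
  have "(\<Prod>k\<in>M. q k + (\<Sum>y\<in>Y. r k y)) = (\<Prod>k\<in>M. (\<Sum>y\<in>Y. r k y) + q k)"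
    by (simp add: add.commute)
  also have "\<dots> = (\<Sum>J\<in>Pow M. (\<Prod>k\<in>J. \<Sum>y\<in>Y. r k y) * (\<Prod>k\<in>M - J. q k))"
    using assms(1) by (rule prod_add)
  finally show ?thesis using inner by simp
qed

lemma sum_associations_factorises:
  fixes p :: "'k \<Rightarrow> 'i \<Rightarrow> 'a::field"
  assumes "finite M" "finite Y"
    and nz: "\<And>y. y \<in> Y \<Longrightarrow> a y + c y \<noteq> 0"
    and excl: "\<And>y k k'. y \<in> Y \<Longrightarrow> k \<in> M \<Longrightarrow> k' \<in> M \<Longrightarrow> k \<noteq> k' \<Longrightarrow> p k y * p k' y = 0"
  shows "(\<Sum>(J, \<tau>, Yu, Yf)\<in>associations M Y.
      ((\<Prod>k\<in>J. p k (\<tau> k)) * (\<Prod>k\<in>M - J. q k)) * ((\<Prod>y\<in>Yu. a y) * (\<Prod>y\<in>Yf. c y))) =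
    (\<Prod>y\<in>Y. a y + c y) * (\<Prod>k\<in>M. q k + (\<Sum>y\<in>Y. p k y / (a y + c y)))"
proof -
  let ?C = "\<lambda>y. a y + c y"
  \<comment> \<open>Each matched observation lacks its factor \<open>?C\<close>; restoring it divides the weight of the
    hypothesis matched to it by the same factor.\<close>
  have restore: "(\<Prod>k\<in>J. p k (\<tau> k)) * (\<Prod>k\<in>M - J. q k) * (\<Prod>y\<in>Y - \<tau> ` J. ?C y) =
      (\<Prod>y\<in>Y. ?C y) * ((\<Prod>k\<in>J. p k (\<tau> k) / ?C (\<tau> k)) * (\<Prod>k\<in>M - J. q k))"
    if "\<tau> \<in> J \<rightarrow>\<^sub>E Y" "inj_on \<tau> J" for J \<tau>
  proof -
    have sub: "\<tau> ` J \<subseteq> Y" using that(1) by auto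
    have "(\<Prod>y\<in>Y. ?C y) = (\<Prod>y\<in>Y - \<tau> ` J. ?C y) * (\<Prod>y\<in>\<tau> ` J. ?C y)"
      using prod.subset_diff[OF sub assms(2)] .
    also have "(\<Prod>y\<in>\<tau> ` J. ?C y) = (\<Prod>k\<in>J. ?C (\<tau> k))"
      using that(2) by (simp add: prod.reindex)
    finally have split: "(\<Prod>y\<in>Y. ?C y) = (\<Prod>y\<in>Y - \<tau> ` J. ?C y) * (\<Prod>k\<in>J. ?C (\<tau> k))" .
    have "(\<Prod>k\<in>J. ?C (\<tau> k)) * (\<Prod>k\<in>J. p k (\<tau> k) / ?C (\<tau> k)) = (\<Prod>k\<in>J. p k (\<tau> k))"
      unfolding prod.distrib[symmetric] using nz sub by (intro prod.cong) auto
    from this[symmetric] show ?thesis unfolding split by (simp only: mult_ac)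
  qed
  have "(\<Sum>J\<in>Pow M. \<Sum>\<tau>\<in>{\<tau> \<in> J \<rightarrow>\<^sub>E Y. inj_on \<tau> J}.
        (\<Prod>k\<in>J. p k (\<tau> k)) * (\<Prod>k\<in>M - J. q k) * (\<Prod>y\<in>Y - \<tau> ` J. ?C y)) =
      (\<Prod>y\<in>Y. ?C y) * (\<Sum>J\<in>Pow M. \<Sum>\<tau>\<in>{\<tau> \<in> J \<rightarrow>\<^sub>E Y. inj_on \<tau> J}.
        (\<Prod>k\<in>J. p k (\<tau> k) / ?C (\<tau> k)) * (\<Prod>k\<in>M - J. q k))"
    unfolding sum_distrib_left by (intro sum.cong refl restore) auto
  also have "(\<Sum>J\<in>Pow M. \<Sum>\<tau>\<in>{\<tau> \<in> J \<rightarrow>\<^sub>E Y. inj_on \<tau> J}.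
        (\<Prod>k\<in>J. p k (\<tau> k) / ?C (\<tau> k)) * (\<Prod>k\<in>M - J. q k)) =
      (\<Prod>k\<in>M. q k + (\<Sum>y\<in>Y. p k y / ?C y))"
  proof (rule sum_partial_injections[OF assms(1,2)])
    fix y k k' assume "y \<in> Y" "k \<in> M" "k' \<in> M" "k \<noteq> k'"
    then have "p k y * p k' y = 0" by (rule excl)
    then show "p k y / ?C y * (p k' y / ?C y) = 0" by simp
  qed
  finally show ?thesis
    unfolding sum_associations[OF assms(1,2), where w = "\<lambda>J \<tau>. (\<Prod>k\<in>J. p k (\<tau> k)) * (\<Prod>k\<in>M - J. q k)"] .
qed

text \<open>
  The bound on \<open>n\<close> keeps every exponent \<open>n - card Yu\<close> from truncating, so that
  $\bar p^u(\phi)^n$ can be taken out of each association's weight.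
\<close>

lemma marginal_lik_factorises:
  fixes U :: "('d::finite, 'b::euclidean_space, 'i, 'k) update"
  assumes "finite M" "finite S" "Y \<subseteq> S" "card Y \<le> n"
    and u: "Y \<noteq> {} \<Longrightarrow> pbar_d U (und U) (phi U) \<noteq> 0"
    and b: "\<And>y. y \<in> Y \<Longrightarrow> pbar_fa_phi U y \<noteq> 0"
    and nz: "\<And>y. y \<in> Y \<Longrightarrow> C_uf U y \<noteq> 0"
    and excl: "\<And>y k k'. y \<in> Y \<Longrightarrow> k \<in> M \<Longrightarrow> k' \<in> M \<Longrightarrow> k \<noteq> k' \<Longrightarrow> p_d U k y * p_d U k' y = 0"
  shows "marginal_lik U M Y S n =
    pbar_d U (und U) (phi U) ^ n * (\<Prod>y\<in>S. pbar_fa_phi U y) * (\<Prod>y\<in>Y. C_uf U y) *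
    (\<Prod>k\<in>M. pbar_d U k (phi U) + (\<Sum>y\<in>Y. p_d U k y / C_uf U y))"
proof -
  let ?u = "pbar_d U (und U) (phi U)"
  let ?b = "pbar_fa_phi U"
  let ?a = "\<lambda>y. p_d U (und U) y / ?u"
  let ?c = "\<lambda>y. p_fa U y / ?b y"
  let ?w = "\<lambda>J \<tau>. (\<Prod>k\<in>J. p_d U k (\<tau> k)) * (\<Prod>k\<in>M - J. pbar_d U k (phi U))"
  have finY: "finite Y" using assms(2,3) finite_subset by blast
  have und_part: "?u ^ (n - card Yu) * (\<Prod>y\<in>Yu. p_d U (und U) y) = ?u ^ n * (\<Prod>y\<in>Yu. ?a y)"
    if Yu: "Yu \<subseteq> Y" for Yu
    \<comment> \<open>The ratios need $\bar p^u(\phi) \<noteq> 0$, which is known only if there is an observation.\<close>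
  proof (cases "Yu = {}")
    case False
    then have "?u \<noteq> 0" using u Yu by blast
    moreover have "?u ^ n = ?u ^ (n - card Yu) * ?u ^ card Yu"
      using card_mono[OF finY Yu] assms(4) by (simp flip: power_add)
    ultimately show ?thesis by (simp add: prod_dividef)
  qed simp
  have fa_part: "(\<Prod>y\<in>Yf. p_fa U y) * (\<Prod>y\<in>S - Yf. ?b y) = (\<Prod>y\<in>S. ?b y) * (\<Prod>y\<in>Yf. ?c y)"
    if Yf: "Yf \<subseteq> Y" for Yf
  proof -
    have split: "(\<Prod>y\<in>S. ?b y) = (\<Prod>y\<in>S - Yf. ?b y) * (\<Prod>y\<in>Yf. ?b y)"
      using Yf assms(2,3) by (intro prod.subset_diff) auto
    have "(\<Prod>y\<in>Yf. ?b y) * (\<Prod>y\<in>Yf. ?c y) = (\<Prod>y\<in>Yf. p_fa U y)"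
      unfolding prod.distrib[symmetric] using b Yf by (intro prod.cong) auto
    from this[symmetric] show ?thesis unfolding split by (simp only: mult_ac)
  qed
  have "marginal_lik U M Y S n = (\<Sum>(J, \<tau>, Yu, Yf)\<in>associations M Y.
      (?u ^ n * (\<Prod>y\<in>S. ?b y)) * (?w J \<tau> * ((\<Prod>y\<in>Yu. ?a y) * (\<Prod>y\<in>Yf. ?c y))))"
    unfolding marginal_lik_def
  proof (rule sum.cong[OF refl], clarify)
    fix J \<tau> Yu Yf assume "(J, \<tau>, Yu, Yf) \<in> associations M Y"
    then have Yu: "Yu \<subseteq> Y" and Yf: "Yf \<subseteq> Y" unfolding associations_def by auto
    have "(\<Prod>k\<in>J. p_d U k (\<tau> k)) * (\<Prod>k\<in>M - J. pbar_d U k (phi U)) * ?u ^ (n - card Yu) *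
          (\<Prod>y\<in>Yu. p_d U (und U) y) * (\<Prod>y\<in>Yf. p_fa U y) * (\<Prod>y\<in>S - Yf. ?b y) =
        ?w J \<tau> * (?u ^ (n - card Yu) * (\<Prod>y\<in>Yu. p_d U (und U) y)) *
          ((\<Prod>y\<in>Yf. p_fa U y) * (\<Prod>y\<in>S - Yf. ?b y))"
      by (simp only: mult.assoc)
    also have "\<dots> = (?u ^ n * (\<Prod>y\<in>S. ?b y)) * (?w J \<tau> * ((\<Prod>y\<in>Yu. ?a y) * (\<Prod>y\<in>Yf. ?c y)))"
      unfolding und_part[OF Yu] fa_part[OF Yf] by (simp only: mult_ac)
    finally show "(\<Prod>k\<in>J. p_d U k (\<tau> k)) * (\<Prod>k\<in>M - J. pbar_d U k (phi U)) * ?u ^ (n - card Yu) *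
          (\<Prod>y\<in>Yu. p_d U (und U) y) * (\<Prod>y\<in>Yf. p_fa U y) * (\<Prod>y\<in>S - Yf. ?b y) =
        (?u ^ n * (\<Prod>y\<in>S. ?b y)) * (?w J \<tau> * ((\<Prod>y\<in>Yu. ?a y) * (\<Prod>y\<in>Yf. ?c y)))" .
  qed
  also have "\<dots> = (?u ^ n * (\<Prod>y\<in>S. ?b y)) * (\<Sum>(J, \<tau>, Yu, Yf)\<in>associations M Y.
      ?w J \<tau> * ((\<Prod>y\<in>Yu. ?a y) * (\<Prod>y\<in>Yf. ?c y)))"
    by (simp add: sum_distrib_left case_prod_unfold)
  also have "(\<Sum>(J, \<tau>, Yu, Yf)\<in>associations M Y. ?w J \<tau> * ((\<Prod>y\<in>Yu. ?a y) * (\<Prod>y\<in>Yf. ?c y))) =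
      (\<Prod>y\<in>Y. ?a y + ?c y) *
      (\<Prod>k\<in>M. pbar_d U k (phi U) + (\<Sum>y\<in>Y. p_d U k y / (?a y + ?c y)))"
    by (rule sum_associations_factorises[OF assms(1) finY nz[unfolded C_uf_def] excl])
  finally show ?thesis unfolding C_uf_def by (simp only: mult.assoc)
qed

theorem theorem3:
  fixes U :: "('d::finite, 'b::euclidean_space, 'i, 'k) update"
    and k :: 'k and z :: 'i
  assumes "update_model U"
    and "k \<in> hyps U \<union> {und U, flat U}"
    and "z \<in> received U \<union> {phi U}"
    and "\<And>z'. z' \<in> received U - {z} \<Longrightarrow> pbar_d U (und U) (phi U) \<noteq> 0"
    and "\<And>z'. z' \<in> received U - {z} \<Longrightarrow> pbar_fa_phi U z' \<noteq> 0"
    and "\<And>z'. z' \<in> received U - {z} \<Longrightarrow> C_uf U z' \<noteq> 0"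
    and "\<And>z' k' k''. z' \<in> received U - {z} \<Longrightarrow> k' \<in> hyps U - {k} \<Longrightarrow> k'' \<in> hyps U - {k} \<Longrightarrow>
           k' \<noteq> k'' \<Longrightarrow> p_d U k' z' * p_d U k'' z' = 0"
  shows "w_ex U k z =
    C' U k z *
    (\<Prod>k'\<in>hyps U - {k}.
       pbar_d U k' (phi U) + (\<Sum>z'\<in>received U - {z}. p_d U k' z' / C_uf U z'))"
proof -
  let ?n = "n_und U - (if k = und U then 1 else 0)"
  have fin: "finite (hyps U)" "finite (cells U)" and sub: "received U \<subseteq> cells U"
    and many: "card (received U) < n_und U"
    using assms(1) unfolding update_model_def by auto
  have "card (received U - {z}) \<le> card (received U)"
    using fin(2) sub finite_subset by (intro card_mono) auto
  \<comment> \<open>The inequality \<open>many\<close> is strict, so removing one never-detected target leaves enough of them.\<close>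
  then have "card (received U - {z}) \<le> ?n" using many by auto
  moreover have "received U - {z} \<subseteq> cells U - Z_flat U k z"
    using sub unfolding Z_flat_def by auto
  ultimately show ?thesis
    unfolding w_ex_def C'_def using fin assms(4-7)
    by (intro marginal_lik_factorises finite_Diff) (assumption | blast)+
qed

end
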